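(* Let $\gamma\in[0,2)$, $d=\frac{2(\gamma+1)}{2-\gamma}$, and consider the anti-tree over $(X,m)$, $m=1$, with root $o$ and sphere function $s_{k-1}=[k^\gamma]$, $k\ge1$, with intrinsic degree metric $\rho$, together with its associated one-dimensional graph $\tilde b$ over $(\mathbb N_0,\tilde m)$ with intrinsic degree metric $\tilde\rho$. Then for $r\ge0$, $x\in X$ and $r_x=\rho(x,o)$, $$\#B_x(r)=m(B_x(r))=\tilde m(\tilde B_{|x|}(r))\asymp\begin{cases}r^d&: r\ge r_x,\\ r\,r_x^{d-1}&: r\le r_x.\end{cases}$$ In particular, the volume doubling property $V(d,R,\infty)$ holds in every $x\in X$ with $R\ge\rho(x,o)$, that is, there is $C_D>0$ such that $m(B_x(r_2))\le C_D\left(\frac{r_2}{r_1}\right)^dm(B_x(r_1))$ for all $R\le r_1\le r_2<\infty$.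
   Context: For real-valued functions $f,g$, $f\asymp g$ means that there is a constant $C>0$ with $C^{-1}f\le g\le Cf$; $a\wedge b$ denotes the minimum. Anti-tree: $[\cdot]$ denotes the integer part. $X=\bigcup_{k\ge0}S_k$ is a disjoint union with $\#S_k=s_k$, where $s_{k-1}=[k^\gamma]$ for $k\ge1$ (so $S_0=\{o\}$); $b(x,y)=b(y,x)=1$ whenever $x\in S_k$, $y\in S_{k+1}$ for some $k\ge0$ and $b(x,y)=0$ otherwise. $m=1$ is the counting measure; $|x|=k$ for $x\in S_k$ (the combinatorial distance to $o$). Associated one-dimensional graph: on $\tilde X=\mathbb N_0$, $\tilde m(k)=s_k$, $\tilde b(k,k+1)=\tilde b(k+1,k)=s_ks_{k+1}$ for $k\ge0$ and $\tilde b(k,l)=0$ otherwise; $\tilde m(A)=\sum_{k\in A}\tilde m(k)$. Intrinsic degree metric of a graph $b$ over $(X,m)$: with $\operatorname{Deg}(x)=\frac1{m(x)}\sum_yb(x,y)$, $\rho(x,y)=\inf\sum_{j=0}^{k-1}\left(\frac1{\operatorname{Deg}(x_j)}\wedge\frac1{\operatorname{Deg}(x_{j+1})}\right)^{1/2}$, the infimum being over all paths $x=x_0\sim\dots\sim x_k=y$ of consecutive neighbors; $\tilde\rho$ is the same for $\tilde b$ over $(\mathbb N_0,\tilde m)$. Balls: $B_x(r)=\{y\in X:\rho(x,y)\le r\}$ and $\tilde B_k(r)=\{l\in\mathbb N_0:\tilde\rho(k,l)\le r\}$.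
   Formalization: As stated this fails at r=0. The equality m(B_x(r)) = m̃(B̃_{|x|}(r)) is proved for all r≥0 such that B_x(r) contains the sphere of x, the comparison ≍ (for both volumes) for all r≥0 with B_x(r) ≠ {x}, and volume doubling for r_1>0. *)

theory Defs
  imports "HOL-Analysis.Analysis"
begin

text \<open>A weighted graph is given by a vertex set \<open>X\<close>, an edge weight \<open>b\<close> and a vertex measure \<open>m\<close>.
  Vertices \<open>x\<close>, \<open>y\<close> are neighbours iff \<open>b x y > 0\<close>.\<close>

definition Deg :: "'a set \<Rightarrow> ('a \<Rightarrow> 'a \<Rightarrow> real) \<Rightarrow> ('a \<Rightarrow> real) \<Rightarrow> 'a \<Rightarrow> real" where
  "Deg X b m x = (\<Sum>\<^sub>\<infinity>y\<in>X. b x y) / m x"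

text \<open>The one-vertex list is a path from \<open>x\<close> to \<open>x\<close> (it has length 0).\<close>

definition graph_path :: "'a set \<Rightarrow> ('a \<Rightarrow> 'a \<Rightarrow> real) \<Rightarrow> 'a \<Rightarrow> 'a \<Rightarrow> 'a list \<Rightarrow> bool" where
  "graph_path X b x y p \<longleftrightarrow>
     p \<noteq> [] \<and> set p \<subseteq> X \<and> hd p = x \<and> last p = y \<and> successively (\<lambda>u v. b u v > 0) p"

definition path_length :: "'a set \<Rightarrow> ('a \<Rightarrow> 'a \<Rightarrow> real) \<Rightarrow> ('a \<Rightarrow> real) \<Rightarrow> 'a list \<Rightarrow> real" where
  "path_length X b m p =
     (\<Sum>j<length p - 1. sqrt (min (1 / Deg X b m (p ! j)) (1 / Deg X b m (p ! Suc j))))"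

definition degree_metric :: "'a set \<Rightarrow> ('a \<Rightarrow> 'a \<Rightarrow> real) \<Rightarrow> ('a \<Rightarrow> real) \<Rightarrow> 'a \<Rightarrow> 'a \<Rightarrow> real" where
  "degree_metric X b m x y = (INF p\<in>{p. graph_path X b x y p}. path_length X b m p)"

definition metric_ball :: "'a set \<Rightarrow> ('a \<Rightarrow> 'a \<Rightarrow> real) \<Rightarrow> ('a \<Rightarrow> real) \<Rightarrow> 'a \<Rightarrow> real \<Rightarrow> 'a set" where
  "metric_ball X b m x r = {y \<in> X. degree_metric X b m x y \<le> r}"

definition vol :: "('a \<Rightarrow> real) \<Rightarrow> 'a set \<Rightarrow> real" where
  "vol m A = (\<Sum>\<^sub>\<infinity>x\<in>A. m x)"

text \<open>The inequality in the volume doubling property \<open>V(d,R,\<infinity>)\<close> at \<open>x\<close>, with constant \<open>C\<close>.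
  The condition \<open>0 < r\<^sub>1\<close> only matters for \<open>R = 0\<close>, where \<open>r\<^sub>2 / r\<^sub>1\<close> is meaningless at \<open>r\<^sub>1 = 0\<close>.\<close>

definition volume_doubling_at ::
    "'a set \<Rightarrow> ('a \<Rightarrow> 'a \<Rightarrow> real) \<Rightarrow> ('a \<Rightarrow> real) \<Rightarrow> real \<Rightarrow> real \<Rightarrow> real \<Rightarrow> 'a \<Rightarrow> bool" where
  "volume_doubling_at X b m C d R x \<longleftrightarrow>
     (\<forall>r\<^sub>1 r\<^sub>2. 0 < r\<^sub>1 \<longrightarrow> R \<le> r\<^sub>1 \<longrightarrow> r\<^sub>1 \<le> r\<^sub>2 \<longrightarrow>
        vol m (metric_ball X b m x r\<^sub>2)
          \<le> C * (r\<^sub>2 / r\<^sub>1) powr d * vol m (metric_ball X b m x r\<^sub>1))"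

text \<open>\<open>f \<asymp> g\<close> on a set of arguments, with one constant for all of them.\<close>

definition comparable_on :: "'c set \<Rightarrow> ('c \<Rightarrow> real) \<Rightarrow> ('c \<Rightarrow> real) \<Rightarrow> bool" where
  "comparable_on A f g \<longleftrightarrow> (\<exists>C>0. \<forall>z\<in>A. inverse C * f z \<le> g z \<and> g z \<le> C * f z)"

text \<open>The index is shifted: the sphere function satisfies \<open>s (k - 1) = \<lfloor>k powr \<gamma>\<rfloor>\<close> for \<open>k \<ge> 1\<close>.\<close>

definition sphere_size :: "real \<Rightarrow> nat \<Rightarrow> nat" where
  "sphere_size \<gamma> k = nat \<lfloor>real (Suc k) powr \<gamma>\<rfloor>"

definition antitree :: "real \<Rightarrow> (nat \<Rightarrow> 'a set) \<Rightarrow> 'a set \<Rightarrow> ('a \<Rightarrow> 'a \<Rightarrow> real) \<Rightarrow> 'a \<Rightarrow> bool" where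
  "antitree \<gamma> S X b rt \<longleftrightarrow>
     X = (\<Union>k. S k) \<and> disjoint_family S \<and>
     (\<forall>k. finite (S k) \<and> card (S k) = sphere_size \<gamma> k) \<and> S 0 = {rt} \<and>
     (\<forall>x\<in>X. \<forall>y\<in>X. b x y =
        (if \<exists>k. x \<in> S k \<and> y \<in> S (Suc k) \<or> y \<in> S k \<and> x \<in> S (Suc k) then 1 else 0))"

text \<open>The associated one-dimensional graph, on the vertex set \<open>UNIV :: nat set\<close>.\<close>

definition line_measure :: "real \<Rightarrow> nat \<Rightarrow> real" where
  "line_measure \<gamma> k = real (sphere_size \<gamma> k)"

definition line_weight :: "real \<Rightarrow> nat \<Rightarrow> nat \<Rightarrow> real" where
  "line_weight \<gamma> k l =
     (if l = Suc k \<or> k = Suc l then real (sphere_size \<gamma> k) * real (sphere_size \<gamma> l) else 0)"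

text \<open>The model volume of a ball of radius \<open>r\<close> whose centre has distance \<open>r\<^sub>x\<close> to the root. The two
  cases of the definition agree for \<open>r = r\<^sub>x\<close>. Balls so small that they consist of their centre only
  have counting measure 1 and are not comparable to it (it vanishes at \<open>r = 0\<close>).\<close>

definition model_volume :: "real \<Rightarrow> real \<Rightarrow> real \<Rightarrow> real" where
  "model_volume d r\<^sub>x r = (if r \<ge> r\<^sub>x then r powr d else r * r\<^sub>x powr (d - 1))"

end

theory Submission imports Defs begin

text \<open>In both graphs the weighted degree depends only on the level \<open>k\<close> of a vertex and is nondecreasing
  in it, so edges between levels \<open>k\<close> and \<open>k + 1\<close> have a length \<open>w k\<close> of order \<open>(k + 1) powr (- \<gamma> / 2)\<close>.
  Hence vertices in different levels \<open>k\<close>, \<open>l\<close> have distance \<open>\<bar>T k - T l\<bar>\<close>, where \<open>T k\<close>, the sum of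
  \<open>w j\<close> over \<open>j < k\<close>, is of order \<open>k powr a\<close> with \<open>a = 1 - \<gamma> / 2\<close>. A ball with more than one point
  has radius \<open>r \<ge> w k\<close>, and apart from the level of its centre it is the union of the spheres \<open>S l\<close> with
  \<open>\<bar>T k - T l\<bar> \<le> r\<close>; since the next sphere is at least as large, that level does not matter.
  For \<open>r \<ge> T k\<close> these are essentially all levels up to order \<open>r powr (1 / a)\<close>, giving
  \<open>r powr ((\<gamma> + 1) / a)\<close> points. For \<open>r \<le> T k\<close> one writes the size of \<open>S l\<close> as \<open>w l\<close> times a factor of
  order \<open>l powr (3 * \<gamma> / 2)\<close>, that is \<open>T k powr (d - 1)\<close>, and the lengths \<open>w l\<close> sum up to order \<open>r\<close>.\<close>

subsection \<open>Degree metrics of graphs layered by levels\<close>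

text \<open>Covers both graphs at once: the anti-tree, with \<open>h\<close> the level of a vertex,
  and the line, with \<open>h\<close> the identity. As \<open>step\<close> and \<open>radius\<close>
  depend on \<open>D\<close> only, the two graphs share them.\<close>

locale layered_graph =
  fixes X :: "'a set" and b :: "'a \<Rightarrow> 'a \<Rightarrow> real" and m :: "'a \<Rightarrow> real"
    and h :: "'a \<Rightarrow> nat" and D :: "nat \<Rightarrow> real"
  assumes adj: "u \<in> X \<Longrightarrow> v \<in> X \<Longrightarrow> b u v > 0 \<longleftrightarrow> h u = Suc (h v) \<or> h v = Suc (h u)"
    and Deg_eq: "u \<in> X \<Longrightarrow> Deg X b m u = D (h u)"
    and D_pos: "0 < D k"
    and D_mono: "mono D"
    and level_nonempty: "\<exists>u\<in>X. h u = k"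
begin

text \<open>The minimum in the metric is attained at the upper end of an edge, where the degree is
  at least as large.\<close>

definition step :: "nat \<Rightarrow> real" where "step k = 1 / sqrt (D (Suc k))"

definition radius :: "nat \<Rightarrow> real" where "radius n = (\<Sum>j<n. step j)"

lemma step_pos: "0 < step k"
  using D_pos by (simp add: step_def)

lemma step_antimono: "k \<le> l \<Longrightarrow> step l \<le> step k"
  unfolding step_def using D_pos D_mono[THEN monoD, of "Suc k" "Suc l"]
  by (intro divide_left_mono) auto

lemma radius_Suc: "radius (Suc n) = radius n + step n"
  by (simp add: radius_def)

lemma radius_0 [simp]: "radius 0 = 0"
  by (simp add: radius_def)

lemma radius_mono: "k \<le> l \<Longrightarrow> radius k \<le> radius l"
  unfolding radius_def using step_pos by (intro sum_mono2) (auto intro: less_imp_le)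

lemma radius_diff: "k \<le> l \<Longrightarrow> radius l - radius k = (\<Sum>j\<in>{k..<l}. step j)"
  using sum_diff_nat_ivl[of 0 k l step] by (simp add: radius_def atLeast0LessThan)

lemma radius_nonneg: "0 \<le> radius k"
  using radius_mono[of 0 k] by simp

text \<open>Written as differences of radii, edge lengths telescope along monotone paths, and the
  triangle inequality bounds every path from below.\<close>

lemma edge_length:
  assumes "u \<in> X" "v \<in> X" "b u v > 0"
  shows "sqrt (min (1 / Deg X b m u) (1 / Deg X b m v)) = \<bar>radius (h u) - radius (h v)\<bar>"
proof -
  have *: "min (1 / D (Suc k)) (1 / D k) = 1 / D (Suc k)" for k
    using D_pos[of k] D_pos[of "Suc k"] D_mono[THEN monoD, of k "Suc k"]
    by (simp add: min_def frac_le)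
  have "h u = Suc (h v) \<or> h v = Suc (h u)" using adj assms by blast
  then show ?thesis
    using *[of "h v"] *[of "h u"] step_pos[of "h u"] step_pos[of "h v"] assms
    by (auto simp: Deg_eq radius_Suc step_def real_sqrt_divide min.commute)
qed

section \<open>Path lengths and geodesics\<close>

lemma path_length_single [simp]: "path_length X b m [u] = 0"
  by (simp add: path_length_def)

lemma path_length_Cons:
  assumes "set (u # v # p) \<subseteq> X" "b u v > 0"
  shows "path_length X b m (u # v # p)
    = \<bar>radius (h u) - radius (h v)\<bar> + path_length X b m (v # p)"
  using edge_length[of u v] assms
  by (simp add: path_length_def sum.lessThan_Suc_shift del: sum.lessThan_Suc)

lemma path_length_nonneg:
  assumes "graph_path X b x y p" shows "0 \<le> path_length X b m p"
  unfolding path_length_def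
proof (intro sum_nonneg real_sqrt_ge_zero)
  fix j assume "j \<in> {..<length p - 1}"
  then have "p ! j \<in> X" "p ! Suc j \<in> X" using assms by (auto simp: graph_path_def)
  then show "0 \<le> min (1 / Deg X b m (p ! j)) (1 / Deg X b m (p ! Suc j))"
    using D_pos by (simp add: Deg_eq less_imp_le)
qed

lemma path_length_ge:
  assumes "graph_path X b x y p"
  shows "\<bar>radius (h x) - radius (h y)\<bar> \<le> path_length X b m p"
  using assms
proof (induction p arbitrary: x rule: induct_list012)
  case (3 u v p)
  then have "graph_path X b v y (v # p)" "x = u" "set (u # v # p) \<subseteq> X" "b u v > 0"
    by (auto simp: graph_path_def)
  with "3.IH"(2)[of v] path_length_Cons[of u v p] show ?case by simp
qed (auto simp: graph_path_def)

text \<open>Serves for two vertices of one level, where the difference of radii gives nothing. The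
  first edge goes up or down, and going up is never longer than going down.\<close>

lemma path_length_ge_step:
  assumes "graph_path X b x y p" "x \<noteq> y"
  shows "step (h x) \<le> path_length X b m p"
proof -
  obtain v q where p: "p = x # v # q"
    using assms by (cases p rule: remdups_adj.cases) (auto simp: graph_path_def)
  then have *: "set (x # v # q) \<subseteq> X" "b x v > 0" "graph_path X b v y (v # q)"
    using assms by (auto simp: graph_path_def)
  then have "h x = Suc (h v) \<or> h v = Suc (h x)" using adj by auto
  then have "step (h x) \<le> \<bar>radius (h x) - radius (h v)\<bar>"
    using step_pos[of "h v"] step_antimono[of "h v" "h x"] by (auto simp: radius_Suc)
  with path_length_Cons[OF *(1,2)] path_length_nonneg[OF *(3)] p show ?thesis by simp
qed

text \<open>Walk towards level \<open>h y\<close> one level at a time; since consecutive levels are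
  completely joined, the last edge can end in \<open>y\<close> itself.\<close>

lemma geodesic:
  assumes "x \<in> X" "y \<in> X" "h x \<noteq> h y"
  shows "\<exists>p. graph_path X b x y p \<and> path_length X b m p = \<bar>radius (h x) - radius (h y)\<bar>"
  using assms
proof (induction "nat \<bar>int (h x) - int (h y)\<bar>" arbitrary: x rule: less_induct)
  case less
  show ?case
  proof (cases "h x = Suc (h y) \<or> h y = Suc (h x)")
    case True
    then have "graph_path X b x y [x, y]" using less adj by (auto simp: graph_path_def)
    then show ?thesis using path_length_Cons[of x y "[]"] less
      by (intro exI[of _ "[x, y]"]) (auto simp: graph_path_def)
  next
    case False
    \<comment> \<open>The next vertex stays strictly short of level \<open>h y\<close>, because the
      induction hypothesis needs distinct levels.\<close>
    obtain k where k: "k = Suc (h x) \<and> k < h y \<or> h x = Suc k \<and> h y < k"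
    proof (cases "h x < h y")
      case True then show ?thesis using that[of "Suc (h x)"] False by auto
    next
      case F: False then show ?thesis using that[of "h x - 1"] False less.prems(3) by force
    qed
    obtain z where z: "z \<in> X" "h z = k" using level_nonempty by blast
    have "nat \<bar>int (h z) - int (h y)\<bar> < nat \<bar>int (h x) - int (h y)\<bar>"
      using k z by auto
    with less.hyps[of z] z k less.prems obtain p where
      p: "graph_path X b z y p" "path_length X b m p = \<bar>radius (h z) - radius (h y)\<bar>" by auto
    then obtain q where q: "p = z # q" by (cases p) (auto simp: graph_path_def)
    have "b x z > 0" using adj z k less by auto
    then have "graph_path X b x y (x # p)" using p(1) less.prems z q by (auto simp: graph_path_def)
    moreover have "path_length X b m (x # p) = \<bar>radius (h x) - radius (h y)\<bar>"
      using path_length_Cons[of x z q] \<open>b x z > 0\<close> p q calculation k z(2)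
        radius_mono[of "h x" k] radius_mono[of k "h x"] radius_mono[of k "h y"] radius_mono[of "h y" k]
      by (auto simp: graph_path_def)
    ultimately show ?thesis by blast
  qed
qed

text \<open>Makes the infimum in the metric range over a nonempty set. Vertices of one level are
  linked by a detour through the next level.\<close>

lemma graph_path_exists:
  assumes "x \<in> X" "y \<in> X" shows "\<exists>p. graph_path X b x y p"
proof (cases "h x = h y")
  case True
  obtain z where z: "z \<in> X" "h z = Suc (h x)" using level_nonempty by blast
  then obtain p where p: "graph_path X b z y p" using geodesic[of z y] True assms by auto
  then obtain q where "p = z # q" by (cases p) (auto simp: graph_path_def)
  then have "graph_path X b x y (x # p)" using p adj[of x z] z assms by (auto simp: graph_path_def)
  then show ?thesis by blast
qed (use geodesic assms in blast)

section \<open>The metric as an infimum of path lengths\<close>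

lemma degree_metric_ge:
  assumes "x \<in> X" "y \<in> X" "\<And>p. graph_path X b x y p \<Longrightarrow> c \<le> path_length X b m p"
  shows "c \<le> degree_metric X b m x y"
  unfolding degree_metric_def using assms graph_path_exists by (intro cINF_greatest) auto

lemma degree_metric_le:
  assumes "graph_path X b x y p"
  shows "degree_metric X b m x y \<le> path_length X b m p"
  unfolding degree_metric_def using assms path_length_nonneg
  by (intro cINF_lower) (auto intro!: bdd_belowI2)

lemma degree_metric_ge_radius:
  "x \<in> X \<Longrightarrow> y \<in> X \<Longrightarrow> \<bar>radius (h x) - radius (h y)\<bar> \<le> degree_metric X b m x y"
  using degree_metric_ge path_length_ge by blast

lemma degree_metric_ge_step:
  "x \<in> X \<Longrightarrow> y \<in> X \<Longrightarrow> x \<noteq> y \<Longrightarrow> step (h x) \<le> degree_metric X b m x y"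
  using degree_metric_ge path_length_ge_step by blast

lemma degree_metric_eq:
  assumes "x \<in> X" "y \<in> X" "x = y \<or> h x \<noteq> h y"
  shows "degree_metric X b m x y = \<bar>radius (h x) - radius (h y)\<bar>"
proof -
  have "\<exists>p. graph_path X b x y p \<and> path_length X b m p = \<bar>radius (h x) - radius (h y)\<bar>"
  proof (cases "x = y")
    case True
    then show ?thesis using assms by (intro exI[of _ "[x]"]) (auto simp: graph_path_def)
  qed (use assms geodesic in auto)
  then show ?thesis
    using degree_metric_le degree_metric_ge_radius[OF assms(1,2)] by (metis order.antisym)
qed

end

subsection \<open>Volume estimates on the line\<close>

locale antitree_exponent =
  fixes \<gamma> :: real
  assumes \<gamma>_nonneg: "0 \<le> \<gamma>" and \<gamma>_less: "\<gamma> < 2"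
begin

section \<open>Sphere sizes and degrees\<close>

definition s :: "nat \<Rightarrow> real" where "s k = real (sphere_size \<gamma> k)"

text \<open>Number of neighbours of an anti-tree vertex in level \<open>k\<close>; on the line the
  common factor \<open>s k\<close> of the weights cancels against the measure. The case split keeps
  truncated subtraction from counting a sphere below the root.\<close>

definition deg :: "nat \<Rightarrow> real" where
  "deg k = (if k = 0 then 0 else s (k - 1)) + s (Suc k)"

lemma s_le: "s k \<le> real (Suc k) powr \<gamma>"
  by (simp add: s_def sphere_size_def)

lemma one_le_floor: "1 \<le> \<lfloor>real (Suc k) powr \<gamma>\<rfloor>"
  using \<gamma>_nonneg by (simp add: ge_one_powr_ge_zero)

lemma s_ge_1: "1 \<le> s k"
  using one_le_floor[of k] by (simp add: s_def sphere_size_def)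

text \<open>As the floor is at least 1, rounding down loses at most a factor 2.\<close>

lemma s_ge: "real (Suc k) powr \<gamma> / 2 \<le> s k"
proof -
  have "s k = real_of_int \<lfloor>real (Suc k) powr \<gamma>\<rfloor>"
    using one_le_floor[of k] by (simp add: s_def sphere_size_def)
  then show ?thesis using one_le_floor[of k] by linarith
qed

lemma s_mono: "k \<le> l \<Longrightarrow> s k \<le> s l"
  unfolding s_def sphere_size_def using \<gamma>_nonneg
  by (intro of_nat_mono nat_mono floor_mono powr_mono2) auto

lemma deg_Suc: "deg (Suc k) = s k + s (Suc (Suc k))"
  by (simp add: deg_def)

lemma deg_pos: "0 < deg k"
  using s_ge_1[of "k - 1"] s_ge_1[of "Suc k"] by (auto simp: deg_def)

lemma deg_mono: "mono deg"
proof (rule incseq_SucI)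
  fix k show "deg k \<le> deg (Suc k)"
    using s_mono[of "k - 1" k] s_mono[of "Suc k" "Suc (Suc k)"] s_ge_1[of k]
    by (auto simp: deg_def)
qed

sublocale line: layered_graph UNIV "line_weight \<gamma>" "line_measure \<gamma>" "\<lambda>k. k" deg
proof
  fix u v :: nat
  have pos: "0 < sphere_size \<gamma> k" for k using s_ge_1[of k] by (simp add: s_def)
  show "line_weight \<gamma> u v > 0 \<longleftrightarrow> u = Suc v \<or> v = Suc u"
    using pos by (auto simp: line_weight_def)
  \<comment> \<open>At \<open>u = 0\<close> the set is \<open>{0, 1}\<close>, and its element 0
    contributes weight 0.\<close>
  have "(\<Sum>\<^sub>\<infinity>y\<in>UNIV. line_weight \<gamma> u y) = (\<Sum>\<^sub>\<infinity>y\<in>{u - 1, Suc u}. line_weight \<gamma> u y)"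
    by (rule infsum_cong_neutral) (auto simp: line_weight_def)
  also have "\<dots> = (\<Sum>y\<in>{u - 1, Suc u}. line_weight \<gamma> u y)" by simp
  also have "\<dots> = s u * deg u"
    by (cases u) (auto simp: line_weight_def deg_def s_def algebra_simps)
  finally show "Deg UNIV (line_weight \<gamma>) (line_measure \<gamma>) u = deg u"
    using s_ge_1[of u] by (simp add: Deg_def line_measure_def s_def)
qed (use deg_pos deg_mono in auto)

section \<open>Growth of edge lengths and radii\<close>

abbreviation w where "w \<equiv> line.step"
abbreviation T where "T \<equiv> line.radius"

definition a :: real where "a = 1 - \<gamma> / 2"
text \<open>This is the exponent \<open>d\<close> of the theorem: radii grow like
  \<open>k powr a\<close> and volumes up to level \<open>k\<close> like
  \<open>k powr (\<gamma> + 1)\<close>.\<close>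

definition dim :: real where "dim = (\<gamma> + 1) / a"

lemma a_pos: "0 < a" and a_le_1: "a \<le> 1"
  using \<gamma>_nonneg \<gamma>_less by (auto simp: a_def)

lemma dim_ge_1: "1 \<le> dim"
  using a_pos a_le_1 \<gamma>_nonneg by (simp add: dim_def)

lemma a_times_dim: "a * dim = \<gamma> + 1"
  using a_pos by (simp add: dim_def)

lemma a_times_dim_minus_1: "a * (dim - 1) = 3 * \<gamma> / 2"
  using a_times_dim by (simp add: right_diff_distrib) (simp add: a_def)

lemma w_le: "w k \<le> 2 * real (Suc k) powr (- \<gamma> / 2)"
proof -
  let ?x = "real (Suc k) powr \<gamma>"
  have "?x \<le> real (Suc (Suc (Suc k))) powr \<gamma>" using \<gamma>_nonneg by (intro powr_mono2) auto
  \<comment> \<open>The bound \<open>?x / 2\<close> from \<open>s_ge\<close> is weakened to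
    \<open>?x / 4\<close> for the sake of a rational square root.\<close>
  then have "?x / 4 \<le> deg (Suc k)"
    using s_ge[of "Suc (Suc k)"] s_ge_1[of k] powr_ge_zero[of "real (Suc k)" \<gamma>]
    unfolding deg_Suc by linarith
  then have "w k \<le> 1 / sqrt (?x / 4)"
    unfolding line.step_def by (intro divide_left_mono mult_pos_pos) (auto intro: deg_pos)
  also have "\<dots> = 2 * real (Suc k) powr (- \<gamma> / 2)"
    by (simp add: real_sqrt_divide powr_minus powr_half_sqrt[symmetric] powr_powr field_simps)
  finally show ?thesis .
qed

lemma w_ge: "real (Suc k) powr (- \<gamma> / 2) / 5 \<le> w k"
proof -
  let ?x = "real (Suc k) powr \<gamma>"
  have "real (Suc (Suc (Suc k))) powr \<gamma> \<le> (3 * real (Suc k)) powr \<gamma>"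
    using \<gamma>_nonneg by (intro powr_mono2) auto
  also have "\<dots> = 3 powr \<gamma> * ?x" by (rule powr_mult)
  also have "\<dots> \<le> 3 powr 2 * ?x" using \<gamma>_less by (intro mult_right_mono powr_mono) auto
  finally have "s (Suc (Suc k)) \<le> 9 * ?x" using s_le[of "Suc (Suc k)"] by simp
  \<comment> \<open>The two terms add up to at most \<open>10 * ?x\<close>; rounding up to the
    square 25 gives the factor 1/5.\<close>
  then have "deg (Suc k) \<le> 25 * ?x"
    using s_le[of k] powr_ge_zero[of "real (Suc k)" \<gamma>] unfolding deg_Suc by linarith
  then have "1 / sqrt (25 * ?x) \<le> w k"
    unfolding line.step_def using deg_pos[of "Suc k"]
    by (intro divide_left_mono mult_pos_pos) auto
  also have "1 / sqrt (25 * ?x) = real (Suc k) powr (- \<gamma> / 2) / 5"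
    by (simp add: real_sqrt_mult powr_minus powr_half_sqrt[symmetric] powr_powr field_simps)
  finally show ?thesis .
qed

text \<open>Each of the \<open>n\<close> summands is at least
  \<open>n powr (- \<gamma> / 2) / 5\<close>, and \<open>n\<close> copies of this give
  \<open>n powr a / 5\<close>.\<close>

lemma T_ge: "real n powr a / 5 \<le> T n"
proof (cases "n = 0")
  case False
  have "real n powr a / 5 = (\<Sum>j<n. real n powr (- \<gamma> / 2) / 5)"
    using False powr_add[of "real n" 1 "- \<gamma> / 2"] by (simp add: a_def)
  also have "\<dots> \<le> (\<Sum>j<n. w j)"
  proof (rule sum_mono)
    fix j assume "j \<in> {..<n}"
    then have "real n powr (- \<gamma> / 2) \<le> real (Suc j) powr (- \<gamma> / 2)"
      using \<gamma>_nonneg by (intro powr_mono2') auto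
    then show "real n powr (- \<gamma> / 2) / 5 \<le> w j" using w_ge[of j] by simp
  qed
  finally show ?thesis by (simp add: line.radius_def)
qed simp

text \<open>By the mean value theorem, since the derivative of \<open>x powr a\<close> is
  nonincreasing for \<open>a \<le> 1\<close>. It bounds each edge length by an increment of
  \<open>n powr a\<close>, so that the upper bound for \<open>T\<close> telescopes.\<close>

lemma powr_Suc_diff_ge:
  "a * real (Suc n) powr (- \<gamma> / 2) \<le> real (Suc n) powr a - real n powr a"
proof (cases "n = 0")
  case True then show ?thesis using a_le_1 by simp
next
  case False
  have "\<exists>z>real n. z < real (Suc n) \<and>
    real (Suc n) powr a - real n powr a = (real (Suc n) - real n) * (a * z powr (a - 1))"
    using False by (intro MVT2) (auto intro!: derivative_eq_intros)
  then obtain z where z: "real n < z" "z < real (Suc n)"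
    "real (Suc n) powr a - real n powr a = (real (Suc n) - real n) * (a * z powr (a - 1))"
    by blast
  have "real (Suc n) powr (a - 1) \<le> z powr (a - 1)"
    using z a_le_1 by (intro powr_mono2') auto
  then show ?thesis using z a_pos by (simp add: a_def)
qed

lemma T_le: "T n \<le> 2 / a * real n powr a"
proof (induction n)
  case (Suc n)
  have "w n \<le> 2 / a * (a * real (Suc n) powr (- \<gamma> / 2))" using w_le[of n] a_pos by simp
  also have "\<dots> \<le> 2 / a * (real (Suc n) powr a - real n powr a)"
    using powr_Suc_diff_ge a_pos by (intro mult_left_mono) auto
  finally show ?case using Suc.IH by (simp add: line.radius_Suc algebra_simps)
qed simp

section \<open>Balls on the line: extent and volume\<close>

definition line_ball :: "nat \<Rightarrow> real \<Rightarrow> nat set" where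
  "line_ball k r = {l. \<bar>T k - T l\<bar> \<le> r}"

lemma level_le:
  assumes "T l \<le> y" shows "real l \<le> (5 * y) powr (1 / a)"
proof -
  have "real l powr a \<le> 5 * y" using T_ge[of l] assms by simp
  then have "(real l powr a) powr (1 / a) \<le> (5 * y) powr (1 / a)"
    using a_pos by (intro powr_mono2) auto
  then show ?thesis using a_pos by (simp add: powr_powr)
qed

lemma finite_line_ball: "finite (line_ball k r)"
proof (rule finite_subset)
  show "line_ball k r \<subseteq> {..nat \<lfloor>(5 * (T k + r)) powr (1 / a)\<rfloor>}"
  proof
    fix l assume "l \<in> line_ball k r"
    then have "T l \<le> T k + r" by (auto simp: line_ball_def)
    then have "real l \<le> (5 * (T k + r)) powr (1 / a)" by (rule level_le)
    then show "l \<in> {..nat \<lfloor>(5 * (T k + r)) powr (1 / a)\<rfloor>}" by (simp add: le_nat_floor)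
  qed
qed simp

text \<open>\<open>q\<close> is the top level of the ball. The assumption puts level
  \<open>k + 1\<close> into the ball, and by maximality level \<open>q + 1\<close> lies beyond the
  reach \<open>T k + r\<close>.\<close>

lemma Max_line_ball:
  assumes "w k \<le> r"
  obtains q where "Suc k \<le> q" "q \<in> line_ball k r" "line_ball k r \<subseteq> {..q}" "T k + r < T (Suc q)"
    "{k..q} \<subseteq> line_ball k r"
proof
  let ?q = "Max (line_ball k r)"
  have S: "Suc k \<in> line_ball k r" using assms line.step_pos[of k] by (simp add: line_ball_def line.radius_Suc)
  then show q: "?q \<in> line_ball k r" and k: "Suc k \<le> ?q" and sub: "line_ball k r \<subseteq> {..?q}"
    using finite_line_ball by (auto intro: Max_in)
  have "Suc ?q \<notin> line_ball k r" using sub by force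
  then show "T k + r < T (Suc ?q)"
    using line.radius_mono[of k "Suc ?q"] k by (auto simp: line_ball_def)
  show "{k..?q} \<subseteq> line_ball k r"
  proof
    fix l assume "l \<in> {k..?q}"
    then show "l \<in> line_ball k r"
      using q line.radius_mono[of k l] line.radius_mono[of l ?q] by (auto simp: line_ball_def)
  qed
qed

text \<open>All levels of the ball satisfy \<open>T l \<le> 2 * r\<close>, hence
  \<open>l \<le> Y\<close>. These are at most \<open>2 * Y\<close> levels, each of size at most
  \<open>(2 * Y) powr \<gamma>\<close>.\<close>

lemma sum_s_line_ball_le_far:
  assumes r: "w k \<le> r" "T k \<le> r"
  shows "(\<Sum>l\<in>line_ball k r. s l) \<le> 2 powr (\<gamma> + 1) * 10 powr dim * r powr dim"
proof -
  define Y where "Y = (10 * r) powr (1 / a)"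
  \<comment> \<open>Keeping \<open>r\<close> away from 0 yields \<open>1 \<le> Y\<close>, which
    absorbs the additional 1 in the number of levels and in \<open>Suc l\<close>.\<close>
  have "1 / 5 \<le> w 0" using w_ge[of 0] by simp
  also have "w 0 \<le> r"
    using r line.radius_mono[of 1 k] line.radius_Suc[of 0] by (cases "k = 0") auto
  finally have r5: "1 / 5 \<le> r" .
  then have Y: "1 \<le> Y" unfolding Y_def using a_pos by (intro ge_one_powr_ge_zero) auto
  have sub: "line_ball k r \<subseteq> {..nat \<lfloor>Y\<rfloor>}"
  proof
    fix l assume "l \<in> line_ball k r"
    then have "T l \<le> 2 * r" using r by (auto simp: line_ball_def)
    then show "l \<in> {..nat \<lfloor>Y\<rfloor>}" using level_le[of l "2 * r"] by (simp add: Y_def le_nat_floor)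
  qed
  have "(\<Sum>l\<in>line_ball k r. s l) \<le> (\<Sum>l\<le>nat \<lfloor>Y\<rfloor>. s l)"
    using sub s_ge_1 by (intro sum_mono2) (auto intro: order.trans[OF zero_le_one])
  also have "\<dots> \<le> (\<Sum>l\<le>nat \<lfloor>Y\<rfloor>. (2 * Y) powr \<gamma>)"
  proof (rule sum_mono)
    fix l assume "l \<in> {..nat \<lfloor>Y\<rfloor>}"
    then have "real l \<le> Y" using Y by simp linarith
    then have "real (Suc l) powr \<gamma> \<le> (2 * Y) powr \<gamma>"
      using Y \<gamma>_nonneg by (intro powr_mono2) auto
    then show "s l \<le> (2 * Y) powr \<gamma>" using s_le[of l] by simp
  qed
  also have "\<dots> = real (Suc (nat \<lfloor>Y\<rfloor>)) * (2 * Y) powr \<gamma>" by simp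
  also have "\<dots> \<le> (2 * Y) * (2 * Y) powr \<gamma>"
  proof (rule mult_right_mono)
    show "real (Suc (nat \<lfloor>Y\<rfloor>)) \<le> 2 * Y" using Y by simp linarith
  qed simp
  also have "\<dots> = (2 * Y) powr (\<gamma> + 1)" using Y by (simp add: powr_add)
  also have "\<dots> = 2 powr (\<gamma> + 1) * 10 powr dim * r powr dim"
    using r5 by (simp add: Y_def powr_mult powr_powr dim_def)
  finally show ?thesis .
qed

lemma sum_s_line_ball_le_near:
  assumes r: "w k \<le> r" "r \<le> T k"
  shows "(\<Sum>l\<in>line_ball k r. s l)
    \<le> 15 * (1 + (20 / a) powr (1 / a)) powr (3 * \<gamma> / 2) * 5 powr (dim - 1) * (r * T k powr (dim - 1))"
proof -
  define K where "K = 1 + (20 / a) powr (1 / a)"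
  have K: "1 \<le> K" by (simp add: K_def)
  have "k \<noteq> 0" using r line.step_pos[of k] by (intro notI) auto
  then have k: "1 \<le> real k" by simp
  obtain q where q: "Suc k \<le> q" "q \<in> line_ball k r" "line_ball k r \<subseteq> {..q}" by (rule Max_line_ball[OF r(1)])
  define p where "p = Min (line_ball k r)"
  have p: "p \<in> line_ball k r" using q finite_line_ball[of k r] unfolding p_def by (intro Min_in) auto
  have sub: "line_ball k r \<subseteq> {p..q}" using q finite_line_ball[of k r] by (auto simp: p_def)
  have "(\<Sum>l\<in>line_ball k r. w l) \<le> (\<Sum>l\<in>{p..<Suc q}. w l)"
    using sub line.step_pos by (intro sum_mono2) (auto intro: less_imp_le)
  also have "\<dots> = T (Suc q) - T p"
    using line.radius_diff[of p "Suc q"] p sub by force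
  \<comment> \<open>Each side of the centre contributes at most \<open>r\<close>, and so does the
    surplus edge, as \<open>w q \<le> w k\<close>.\<close>
  also have "\<dots> \<le> 3 * r"
    using p q r line.step_antimono[of k q] by (auto simp: line_ball_def line.radius_Suc)
  finally have w_sum: "(\<Sum>l\<in>line_ball k r. w l) \<le> 3 * r" .
  let ?A = "5 * (K * real k) powr (3 * \<gamma> / 2)"
  have "s l \<le> ?A * w l" if "l \<in> line_ball k r" for l
  proof -
    \<comment> \<open>As \<open>r \<le> T k\<close>, the ball stays below a constant multiple of
      level \<open>k\<close>; \<open>K\<close> is this constant, plus 1 to pass from
      \<open>l\<close> to \<open>Suc l\<close>.\<close>
    have "T l \<le> 2 * T k" using that r by (auto simp: line_ball_def)
    also have "\<dots> \<le> 2 * (2 / a * real k powr a)" using T_le[of k] by simp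
    finally have "real l \<le> (5 * (2 * (2 / a * real k powr a))) powr (1 / a)"
      by (rule level_le)
    also have "\<dots> = (20 / a) powr (1 / a) * real k"
      using a_pos by (simp add: powr_mult powr_powr powr_divide)
    finally have "real (Suc l) \<le> K * real k" using k by (simp add: K_def algebra_simps)
    then have *: "real (Suc l) powr (3 * \<gamma> / 2) \<le> (K * real k) powr (3 * \<gamma> / 2)"
      using \<gamma>_nonneg by (intro powr_mono2) auto
    have "s l \<le> real (Suc l) powr (3 * \<gamma> / 2 + - \<gamma> / 2)" using s_le[of l] by simp
    also have "\<dots> = real (Suc l) powr (3 * \<gamma> / 2) * real (Suc l) powr (- \<gamma> / 2)"
      by (rule powr_add)
    also have "\<dots> \<le> (K * real k) powr (3 * \<gamma> / 2) * (5 * w l)"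
      using * w_ge[of l] by (intro mult_mono) auto
    finally show ?thesis by simp
  qed
  then have "(\<Sum>l\<in>line_ball k r. s l) \<le> (\<Sum>l\<in>line_ball k r. ?A * w l)" by (rule sum_mono)
  also have "\<dots> = ?A * (\<Sum>l\<in>line_ball k r. w l)" by (simp add: sum_distrib_left)
  also have "\<dots> \<le> ?A * (3 * r)" using w_sum by (intro mult_left_mono) auto
  also have "\<dots> = 15 * K powr (3 * \<gamma> / 2) * r * (real k powr a) powr (dim - 1)"
    using K by (simp add: powr_mult powr_powr a_times_dim_minus_1)
  also have "\<dots> \<le> 15 * K powr (3 * \<gamma> / 2) * r * (5 * T k) powr (dim - 1)"
    using T_ge[of k] dim_ge_1 r line.step_pos[of k]
    by (intro mult_left_mono powr_mono2) auto
  finally show ?thesis using line.radius_nonneg[of k] by (simp add: K_def powr_mult mult_ac)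
qed

text \<open>The edges from level \<open>k\<close> up to level \<open>q\<close> have total length at
  least \<open>r / 2\<close>. Comparing \<open>w j\<close> with \<open>s (Suc j)\<close> keeps the
  level of the centre out of the resulting sum.\<close>

lemma sum_s_line_ball_ge_near:
  assumes r: "w k \<le> r"
  shows "r * T k powr (dim - 1) \<le> 8 * (2 / a) powr (dim - 1) * (\<Sum>l\<in>line_ball k r - {k}. s l)"
proof -
  obtain q where q: "Suc k \<le> q" "T k + r < T (Suc q)" "{k..q} \<subseteq> line_ball k r"
    using Max_line_ball[OF r(1)] by metis
  \<comment> \<open>\<open>r\<close> is less than \<open>T q - T k + w q\<close>, and
    \<open>w q \<le> w k \<le> T q - T k\<close> since \<open>q > k\<close>.\<close>
  have "r / 2 \<le> T q - T k"
    using q(2) line.radius_mono[OF q(1)] line.step_antimono[of k q] q(1)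
    by (simp add: line.radius_Suc)
  also have "\<dots> = (\<Sum>j\<in>{k..<q}. w j)"
    using line.radius_diff[of k q] q(1) by simp
  finally have "real k powr (3 * \<gamma> / 2) * (r / 2) \<le> real k powr (3 * \<gamma> / 2) * (\<Sum>j\<in>{k..<q}. w j)"
    by (intro mult_left_mono) auto
  also have "\<dots> = (\<Sum>j\<in>{k..<q}. real k powr (3 * \<gamma> / 2) * w j)"
    by (simp add: sum_distrib_left)
  also have "\<dots> \<le> (\<Sum>j\<in>{k..<q}. 4 * s (Suc j))"
  proof (rule sum_mono)
    fix j assume j: "j \<in> {k..<q}"
    have "real k powr (3 * \<gamma> / 2) * w j
        \<le> real (Suc j) powr (3 * \<gamma> / 2) * (2 * real (Suc j) powr (- \<gamma> / 2))"
      using j \<gamma>_nonneg w_le[of j] line.step_pos[of j]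
      by (intro mult_mono powr_mono2) (auto intro: less_imp_le)
    also have "\<dots> = 2 * real (Suc j) powr (3 * \<gamma> / 2 + - \<gamma> / 2)" by (simp only: powr_add mult_ac)
    also have "\<dots> \<le> 2 * real (Suc (Suc j)) powr \<gamma>"
      using \<gamma>_nonneg by (auto intro!: powr_mono2)
    also have "\<dots> \<le> 4 * s (Suc j)" using s_ge[of "Suc j"] by simp
    finally show "real k powr (3 * \<gamma> / 2) * w j \<le> 4 * s (Suc j)" .
  qed
  also have "\<dots> = 4 * (\<Sum>l\<in>{Suc k..<Suc q}. s l)"
    by (simp only: sum_distrib_left[symmetric] sum.shift_bounds_Suc_ivl)
  also have "\<dots> \<le> 4 * (\<Sum>l\<in>line_ball k r - {k}. s l)"
  proof -
    have "{Suc k..<Suc q} \<subseteq> line_ball k r - {k}" using q(3) by force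
    then show ?thesis using finite_line_ball s_ge_1
      by (intro mult_left_mono sum_mono2) (auto intro: order.trans[OF zero_le_one])
  qed
  finally have "(2 / a) powr (dim - 1) * (real k powr (3 * \<gamma> / 2) * r)
      \<le> (2 / a) powr (dim - 1) * (8 * (\<Sum>l\<in>line_ball k r - {k}. s l))"
    by (intro mult_left_mono) auto
  moreover have "r * T k powr (dim - 1) \<le> r * (2 / a * real k powr a) powr (dim - 1)"
    using T_le[of k] line.radius_nonneg[of k] dim_ge_1 r line.step_pos[of k]
    by (intro mult_left_mono powr_mono2) auto
  moreover have "r * (2 / a * real k powr a) powr (dim - 1)
      = (2 / a) powr (dim - 1) * (real k powr (3 * \<gamma> / 2) * r)"
    unfolding powr_mult powr_powr a_times_dim_minus_1 by simp
  ultimately show ?thesis by linarith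
qed

text \<open>The upper half of the levels suffices: at least \<open>n / 2\<close> levels, each of
  size at least \<open>(n / 2) powr \<gamma> / 2\<close>.\<close>

lemma sum_s_ge: "(real n / 2) powr (\<gamma> + 1) / 2 \<le> (\<Sum>l<n. s l)"
proof (cases "n = 0")
  case False
  have "(real n / 2) powr (\<gamma> + 1) / 2 = real n / 2 * ((real n / 2) powr \<gamma> / 2)"
    using False by (simp add: powr_add)
  also have "\<dots> \<le> real (card {n div 2..<n}) * ((real n / 2) powr \<gamma> / 2)"
    by (intro mult_right_mono) (auto simp: of_nat_diff real_of_nat_div)
  also have "\<dots> = (\<Sum>l\<in>{n div 2..<n}. (real n / 2) powr \<gamma> / 2)" by simp
  also have "\<dots> \<le> (\<Sum>l\<in>{n div 2..<n}. s l)"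
  proof (rule sum_mono)
    fix l assume "l \<in> {n div 2..<n}"
    then have "(real n / 2) powr \<gamma> \<le> real (Suc l) powr \<gamma>"
      using \<gamma>_nonneg by (intro powr_mono2) auto
    then show "(real n / 2) powr \<gamma> / 2 \<le> s l" using s_ge[of l] by simp
  qed
  also have "\<dots> \<le> (\<Sum>l<n. s l)"
    using s_ge_1 by (intro sum_mono2) (auto intro: order.trans[OF zero_le_one])
  finally show ?thesis .
qed simp

text \<open>Once \<open>r \<ge> T k\<close>, the ball contains every level up to its top level
  \<open>q\<close>, and \<open>r < T (Suc q)\<close> bounds \<open>q\<close> from below.\<close>

lemma sum_s_line_ball_ge_far:
  assumes r: "w k \<le> r" "T k \<le> r"
  shows "r powr dim \<le> 4 * (2 / a) powr dim * 2 powr (\<gamma> + 1) * (\<Sum>l\<in>line_ball k r - {k}. s l)"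
proof -
  obtain q where q: "Suc k \<le> q" "T k + r < T (Suc q)" "q \<in> line_ball k r"
    using Max_line_ball[OF r(1)] by metis
  have "l \<in> line_ball k r" if "l \<le> q" for l
    using that q r line.radius_mono[of l q] line.radius_nonneg[of l] by (auto simp: line_ball_def)
  then have sub: "{..<Suc q} - {k} \<subseteq> line_ball k r - {k}" by auto
  have le: "(\<Sum>l\<in>{..<Suc q} - {k}. s l) \<le> (\<Sum>l\<in>line_ball k r - {k}. s l)"
    using sub finite_line_ball s_ge_1 by (intro sum_mono2) (auto intro: order.trans[OF zero_le_one])
  \<comment> \<open>The omitted level \<open>k\<close> is compensated by level \<open>q > k\<close>,
    so leaving it out costs at most a factor 2.\<close>
  have "s k \<le> s q" using q by (intro s_mono) simp
  also have "s q \<le> (\<Sum>l\<in>{..<Suc q} - {k}. s l)"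
    using q s_ge_1 by (intro member_le_sum) (auto intro: order.trans[OF zero_le_one])
  finally have "(\<Sum>l<Suc q. s l) \<le> 2 * (\<Sum>l\<in>{..<Suc q} - {k}. s l)"
    using q by (subst sum.remove[of _ k]) auto
  then have sum: "(real (Suc q) / 2) powr (\<gamma> + 1) \<le> 4 * (\<Sum>l\<in>line_ball k r - {k}. s l)"
    using le sum_s_ge[of "Suc q"] by linarith
  have "r powr dim \<le> (2 / a * real (Suc q) powr a) powr dim"
    using T_le[of "Suc q"] q r line.radius_nonneg[of k] dim_ge_1 by (intro powr_mono2) auto
  also have "\<dots> = (2 / a) powr dim * 2 powr (\<gamma> + 1) * (real (Suc q) / 2) powr (\<gamma> + 1)"
    using a_pos by (simp add: powr_mult powr_divide powr_powr a_times_dim)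
  also have "\<dots> \<le> (2 / a) powr dim * 2 powr (\<gamma> + 1) * (4 * (\<Sum>l\<in>line_ball k r - {k}. s l))"
    using sum by (intro mult_left_mono) auto
  finally show ?thesis by (simp add: mult_ac)
qed

text \<open>The upper bound includes the level of the centre, the lower bound leaves it out. The
  volumes of the balls in both graphs lie between the two sums.\<close>

lemma sum_s_line_ball_comparable:
  obtains C where "1 \<le> C"
    and "\<And>k r. w k \<le> r \<Longrightarrow> (\<Sum>l\<in>line_ball k r. s l) \<le> C * model_volume dim (T k) r"
    and "\<And>k r. w k \<le> r \<Longrightarrow> model_volume dim (T k) r \<le> C * (\<Sum>l\<in>line_ball k r - {k}. s l)"
proof -
  define C1 where "C1 = 2 powr (\<gamma> + 1) * 10 powr dim"
  define C2 where "C2 = 15 * (1 + (20 / a) powr (1 / a)) powr (3 * \<gamma> / 2) * 5 powr (dim - 1)"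
  define C3 where "C3 = 8 * (2 / a) powr (dim - 1)"
  define C4 where "C4 = 4 * (2 / a) powr dim * 2 powr (\<gamma> + 1)"
  define C where "C = 1 + C1 + C2 + C3 + C4"
  have "0 \<le> C1" "0 \<le> C2" "0 \<le> C3" "0 \<le> C4" by (simp_all add: C1_def C2_def C3_def C4_def)
  then have C: "1 \<le> C" "C1 \<le> C" "C2 \<le> C" "C3 \<le> C" "C4 \<le> C" by (simp_all add: C_def)
  show ?thesis
  proof
    fix k r assume r: "w k \<le> r"
    have m0: "0 \<le> model_volume dim (T k) r"
      using r line.step_pos[of k] by (simp add: model_volume_def)
    have s0: "0 \<le> (\<Sum>l\<in>line_ball k r - {k}. s l)"
      using s_ge_1 by (intro sum_nonneg) (auto intro: order.trans[OF zero_le_one])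
    show "(\<Sum>l\<in>line_ball k r. s l) \<le> C * model_volume dim (T k) r"
    proof (cases "T k \<le> r")
      case True
      then show ?thesis
        using sum_s_line_ball_le_far[OF r True] mult_right_mono[OF C(2) m0]
        by (simp add: model_volume_def C1_def)
    next
      case False
      then show ?thesis
        using sum_s_line_ball_le_near[OF r] mult_right_mono[OF C(3) m0]
        by (simp add: model_volume_def C2_def)
    qed
    show "model_volume dim (T k) r \<le> C * (\<Sum>l\<in>line_ball k r - {k}. s l)"
    proof (cases "T k \<le> r")
      case True
      then show ?thesis
        using sum_s_line_ball_ge_far[OF r True] mult_right_mono[OF C(5) s0]
        by (simp add: model_volume_def C4_def)
    next
      case False
      then show ?thesis
        using sum_s_line_ball_ge_near[OF r] mult_right_mono[OF C(4) s0]
        by (simp add: model_volume_def C3_def)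
    qed
  qed (rule C)
qed

end

subsection \<open>Volumes in the anti-tree\<close>

lemma antitree_layered:
  assumes "antitree_exponent \<gamma>" "antitree \<gamma> S X b rt" "m = (\<lambda>_. 1)"
    and h: "\<And>x k. x \<in> S k \<Longrightarrow> h x = k"
  shows "layered_graph X b m h (antitree_exponent.deg \<gamma>)"
proof -
  interpret antitree_exponent \<gamma> by fact
  have X: "X = (\<Union>k. S k)" and fin: "\<And>k. finite (S k)"
    and card: "\<And>k. real (card (S k)) = s k"
    and b: "\<And>x y. x \<in> X \<Longrightarrow> y \<in> X \<Longrightarrow> b x y =
        (if \<exists>k. x \<in> S k \<and> y \<in> S (Suc k) \<or> y \<in> S k \<and> x \<in> S (Suc k) then 1 else 0)"
    using assms(2) unfolding antitree_def by (auto simp: s_def)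
  have S: "x \<in> S k \<longleftrightarrow> x \<in> X \<and> h x = k" for x k using X h by auto
  have b: "b x y = (if h x = Suc (h y) \<or> h y = Suc (h x) then 1 else 0)"
    if "x \<in> X" "y \<in> X" for x y
    using that unfolding b[OF that] S by auto
  show ?thesis
  proof
    fix u v assume u: "u \<in> X" and v: "v \<in> X"
    show "b u v > 0 \<longleftrightarrow> h u = Suc (h v) \<or> h v = Suc (h u)" using b[OF u v] by simp
  next
    fix u assume u: "u \<in> X"
    \<comment> \<open>\<open>N\<close> is the sphere below \<open>u\<close>, empty at the root in
      accordance with the case split in \<open>deg\<close>.\<close>
    define N where "N = (if h u = 0 then {} else S (h u - 1))"
    have "(\<Sum>\<^sub>\<infinity>y\<in>X. b u y) = (\<Sum>\<^sub>\<infinity>y\<in>N \<union> S (Suc (h u)). 1)"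
      by (rule infsum_cong_neutral) (use u b in \<open>auto simp: N_def S split: if_splits\<close>)
    also have "\<dots> = real (card (N \<union> S (Suc (h u))))" by (simp add: fin N_def)
    also have "card (N \<union> S (Suc (h u))) = card N + card (S (Suc (h u)))"
      by (rule card_Un_disjoint) (auto simp: N_def fin S)
    also have "real \<dots> = deg (h u)" using card by (simp add: N_def deg_def)
    finally show "Deg X b m u = deg (h u)" by (simp add: Deg_def assms)
  next
    fix k
    have "card (S k) > 0" using card[of k] s_ge_1[of k] by simp
    then have "S k \<noteq> {}" by auto
    then show "\<exists>u\<in>X. h u = k" using S by blast
  qed (use deg_pos deg_mono in auto)
qed

text \<open>Equality of volumes is stated for balls that contain the whole level of their centre:
  other vertices of that level have positive distance to the centre, whereas the line ball counts
  the entire level for every \<open>r \<ge> 0\<close>.\<close>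

theorem lemma4p5:
  fixes \<gamma> d :: real
    and S :: "nat \<Rightarrow> 'a set" and X :: "'a set" and b :: "'a \<Rightarrow> 'a \<Rightarrow> real" and rt :: 'a
    and m :: "'a \<Rightarrow> real"
    and \<rho> :: "'a \<Rightarrow> 'a \<Rightarrow> real"
    and B :: "'a \<Rightarrow> real \<Rightarrow> 'a set" and B' :: "nat \<Rightarrow> real \<Rightarrow> nat set"
  assumes "0 \<le> \<gamma>" and "\<gamma> < 2"
    and "d = 2 * (\<gamma> + 1) / (2 - \<gamma>)"
    and "antitree \<gamma> S X b rt"
    and "m = (\<lambda>_. 1)"
    and "\<rho> = degree_metric X b m"
    and "B = metric_ball X b m"
    and "B' = metric_ball UNIV (line_weight \<gamma>) (line_measure \<gamma>)"
  shows
    "(\<forall>x\<in>X. \<forall>r\<ge>0. finite (B x r) \<and> real (card (B x r)) = vol m (B x r)) \<and>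
     (\<forall>k. \<forall>x\<in>S k. \<forall>r\<ge>0. S k \<subseteq> B x r \<longrightarrow> vol m (B x r) = vol (line_measure \<gamma>) (B' k r)) \<and>
     comparable_on {(x, r). x \<in> X \<and> 0 \<le> r \<and> B x r \<noteq> {x}}
       (\<lambda>(x, r). vol m (B x r))
       (\<lambda>(x, r). model_volume d (\<rho> x rt) r) \<and>
     comparable_on {(k, x, r). x \<in> S k \<and> 0 \<le> r \<and> B x r \<noteq> {x}}
       (\<lambda>(k, x, r). vol (line_measure \<gamma>) (B' k r))
       (\<lambda>(k, x, r). model_volume d (\<rho> x rt) r) \<and>
     (\<exists>C\<^sub>D>0. \<forall>R. \<forall>x\<in>X. \<rho> x rt \<le> R \<longrightarrow> volume_doubling_at X b m C\<^sub>D d R x)"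
proof -
  interpret antitree_exponent \<gamma> using assms by unfold_locales
  have d: "d = dim" using assms(2,3) by (simp add: dim_def a_def field_simps)
  have X: "X = (\<Union>k. S k)" and disj: "disjoint_family S" and fin_S: "finite (S k)"
    and card_S: "real (card (S k)) = s k" and S0: "S 0 = {rt}" for k
    using assms(4) unfolding antitree_def by (auto simp: s_def)
  define h where "h x = (THE k. x \<in> S k)" for x
  have h: "h x = k" if "x \<in> S k" for x k
    using that disj unfolding h_def disjoint_family_on_def by (intro the_equality) auto
  have S: "x \<in> S k \<longleftrightarrow> x \<in> X \<and> h x = k" for x k using X h by auto
  interpret G: layered_graph X b m h deg
    using antitree_layered[OF antitree_exponent_axioms assms(4,5)] h by blast

  have levels: "finite {y \<in> X. h y \<in> A}" "real (card {y \<in> X. h y \<in> A}) = (\<Sum>l\<in>A. s l)"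
    if "finite A" for A
  proof -
    have eq: "{y \<in> X. h y \<in> A} = (\<Union>l\<in>A. S l)" using S by auto
    show "finite {y \<in> X. h y \<in> A}" unfolding eq using that fin_S by auto
    have "card (\<Union>l\<in>A. S l) = (\<Sum>l\<in>A. card (S l))"
      using that fin_S disj by (intro card_UN_disjoint) (auto simp: disjoint_family_on_def)
    then show "real (card {y \<in> X. h y \<in> A}) = (\<Sum>l\<in>A. s l)" by (simp add: eq card_S)
  qed
  \<comment> \<open>The distance formula determines the ball except within the level of its
    centre.\<close>
  have B_sub: "B x r \<subseteq> {y \<in> X. h y \<in> line_ball (h x) r}" if "x \<in> X" for x r
    using that G.degree_metric_ge_radius[of x] by (force simp: assms(7) metric_ball_def line_ball_def)
  have B_sup: "{y \<in> X. h y \<in> line_ball (h x) r - {h x}} \<subseteq> B x r" if "x \<in> X" for x r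
    using that G.degree_metric_eq[of x] by (auto simp: assms(7) metric_ball_def line_ball_def)
  have self: "x \<in> B x r" if "x \<in> X" "0 \<le> r" for x r
    using that G.degree_metric_eq[of x x] by (simp add: assms(7) metric_ball_def)
  have fin_B: "finite (B x r)" if "x \<in> X" for x r
    using finite_subset[OF B_sub[OF that] levels(1)[OF finite_line_ball]] .
  have vol_B: "vol m (B x r) = real (card (B x r))" if "x \<in> X" for x r
    using fin_B[OF that] by (simp add: vol_def assms(5))
  have B'_eq: "B' k r = line_ball k r" for k r
    using line.degree_metric_eq[of k] by (auto simp: assms(8) metric_ball_def line_ball_def)
  have vol_B': "vol (line_measure \<gamma>) (B' k r) = (\<Sum>l\<in>line_ball k r. s l)" for k r
    by (simp add: B'_eq vol_def finite_line_ball line_measure_def s_def)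
  have vol_le: "vol m (B x r) \<le> (\<Sum>l\<in>line_ball (h x) r. s l)" if "x \<in> X" for x r
    using card_mono[OF levels(1)[OF finite_line_ball] B_sub[OF that]]
    by (simp add: vol_B[OF that] flip: levels(2)[OF finite_line_ball])
  have vol_ge: "(\<Sum>l\<in>line_ball (h x) r - {h x}. s l) \<le> vol m (B x r)" if "x \<in> X" for x r
    using card_mono[OF fin_B[OF that] B_sup[OF that]] finite_line_ball
    by (simp add: vol_B[OF that] flip: levels(2))
  have rho: "\<rho> x rt = T (h x)" if "x \<in> X" for x
  proof -
    have "rt \<in> X" "h rt = 0" using S S0 by auto
    \<comment> \<open>Level 0 consists of the root alone, so the distance formula applies to every
      \<open>x\<close>.\<close>
    moreover have "x = rt" if "h x = 0" using \<open>x \<in> X\<close> that S[of x 0] S0 by simp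
    ultimately show ?thesis
      using G.degree_metric_eq[of x rt] that line.radius_nonneg[of "h x"] by (auto simp: assms(6))
  qed
  have w_le_r: "w (h x) \<le> r" if x: "x \<in> X" "0 \<le> r" "B x r \<noteq> {x}" for x r
  proof -
    obtain y where "y \<in> B x r" "y \<noteq> x" using self[OF x(1,2)] x(3) by auto
    then show ?thesis
      using G.degree_metric_ge_step[OF x(1), of y] by (simp add: assms(7) metric_ball_def)
  qed

  obtain C where C: "1 \<le> C"
    and upper: "\<And>k r. w k \<le> r \<Longrightarrow> (\<Sum>l\<in>line_ball k r. s l) \<le> C * model_volume d (T k) r"
    and lower: "\<And>k r. w k \<le> r \<Longrightarrow> model_volume d (T k) r \<le> C * (\<Sum>l\<in>line_ball k r - {k}. s l)"
    unfolding d using sum_s_line_ball_comparable by metis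
  \<comment> \<open>Allowing any \<open>v\<close> between the two sums serves the anti-tree and the
    line at once.\<close>
  have comparable: "inverse C * v \<le> model_volume d (\<rho> x rt) r \<and> model_volume d (\<rho> x rt) r \<le> C * v"
    if x: "x \<in> X" "0 \<le> r" "B x r \<noteq> {x}"
      and v: "v \<le> (\<Sum>l\<in>line_ball (h x) r. s l)" "(\<Sum>l\<in>line_ball (h x) r - {h x}. s l) \<le> v" for x r v
  proof -
    note r = w_le_r[OF x]
    have "v \<le> C * model_volume d (T (h x)) r" using v(1) upper[OF r] by simp
    moreover have "C * (\<Sum>l\<in>line_ball (h x) r - {h x}. s l) \<le> C * v"
      using v(2) C by (intro mult_left_mono) auto
    ultimately have "v \<le> C * model_volume d (T (h x)) r" "model_volume d (T (h x)) r \<le> C * v"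
      using lower[OF r] by linarith+
    then show ?thesis using C by (simp add: rho x(1) field_simps)
  qed
  \<comment> \<open>One factor \<open>C\<close> comes from the upper bound at \<open>r2\<close>, the
    other from the lower bound at \<open>r1\<close>. Both radii are at least \<open>T (h x)\<close>,
    where the model volume is a pure power.\<close>
  have doubling: "volume_doubling_at X b m (C * C) d R x" if x: "x \<in> X" "\<rho> x rt \<le> R" for R x
    unfolding volume_doubling_at_def assms(7)[symmetric]
  proof (intro allI impI)
    fix r1 r2 assume r: "0 < r1" "R \<le> r1" "r1 \<le> r2"
    let ?k = "h x"
    have T: "T ?k \<le> r1" using x r rho by simp
    have q1: "1 \<le> (r2 / r1) powr d" using r dim_ge_1 d by (intro ge_one_powr_ge_zero) auto
    have r2_eq: "r2 powr d = (r2 / r1) powr d * r1 powr d" using r by (simp flip: powr_mult)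
    have up: "vol m (B x r2) \<le> C * r2 powr d" if "w ?k \<le> r2"
      using upper[OF that] vol_le[OF x(1), of r2] T r by (simp add: model_volume_def)
    show "vol m (B x r2) \<le> C * C * (r2 / r1) powr d * vol m (B x r1)"
    proof (cases "w ?k \<le> r1")
      case True
      have "C * (\<Sum>l\<in>line_ball ?k r1 - {?k}. s l) \<le> C * vol m (B x r1)"
        using vol_ge[OF x(1)] C by (intro mult_left_mono) auto
      then have "r1 powr d \<le> C * vol m (B x r1)"
        using lower[OF True] T by (simp add: model_volume_def)
      then have "C * (r2 / r1) powr d * r1 powr d \<le> C * (r2 / r1) powr d * (C * vol m (B x r1))"
        using C by (intro mult_left_mono) auto
      with up True r show ?thesis by (simp add: r2_eq mult_ac)
    next
      case False
      \<comment> \<open>Otherwise \<open>w ?k \<le> w 0 = T 1 \<le> T ?k \<le> r1\<close>.\<close>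
      have k: "?k = 0"
      proof (rule ccontr)
        assume "?k \<noteq> 0"
        then have "w ?k \<le> T ?k"
          using line.radius_mono[of 1 ?k] line.radius_Suc[of 0] line.step_antimono[of 0 ?k] by simp
        then show False using False T by simp
      qed
      \<comment> \<open>The ball may be the root alone, which the model volume does not see.\<close>
      have "1 \<le> deg (Suc 0)"
        using s_ge_1[of 0] s_ge_1[of "Suc (Suc 0)"] unfolding deg_Suc by linarith
      then have "w 0 \<le> 1" by (simp add: line.step_def)
      then have "r1 \<le> 1" using False k by simp
      then have r1d: "r1 powr d \<le> 1" using r dim_ge_1 d by (intro powr_le1) auto
      have "card (B x r1) \<noteq> 0" using self[OF x(1), of r1] fin_B[OF x(1)] r by auto
      then have one: "1 \<le> vol m (B x r1)" by (simp add: vol_B x(1))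
      have CC: "C \<le> C * C" using C by simp
      \<comment> \<open>As \<open>r1 powr d \<le> 1\<close>, dividing \<open>r2 powr d\<close> by it
        only enlarges it; if \<open>r2 < w ?k\<close>, the larger ball is still a single
        point.\<close>
      have "vol m (B x r2) \<le> C * (r2 / r1) powr d"
      proof (cases "w ?k \<le> r2")
        case True
        have "C * r2 powr d \<le> C * (r2 / r1) powr d"
          unfolding r2_eq using C mult_left_mono[OF r1d, of "(r2 / r1) powr d"]
          by (intro mult_left_mono) auto
        with up[OF True] show ?thesis by linarith
      next
        case False
        then have "B x r2 = {x}" using w_le_r[OF x(1), of r2] r by auto
        then have "vol m (B x r2) = 1" by (simp add: vol_def assms(5))
        then show ?thesis using mult_mono[OF C q1] C by simp
      qed
      also have "\<dots> \<le> C * C * (r2 / r1) powr d * 1" using CC by (simp add: mult_right_mono)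
      also have "\<dots> \<le> C * C * (r2 / r1) powr d * vol m (B x r1)"
        using one C by (intro mult_left_mono) auto
      finally show ?thesis .
    qed
  qed

  show ?thesis
  proof (intro conjI)
    show "\<forall>x\<in>X. \<forall>r\<ge>0. finite (B x r) \<and> real (card (B x r)) = vol m (B x r)"
      using fin_B vol_B by simp
    show "\<forall>k. \<forall>x\<in>S k. \<forall>r\<ge>0. S k \<subseteq> B x r \<longrightarrow> vol m (B x r) = vol (line_measure \<gamma>) (B' k r)"
    proof (intro allI ballI impI)
      fix k x and r :: real assume x: "x \<in> S k" and "0 \<le> r" and sub: "S k \<subseteq> B x r"
      have hx: "x \<in> X" "h x = k" using x S by auto
      have "B x r = {y \<in> X. h y \<in> line_ball k r}"
        using B_sub[OF hx(1), of r] B_sup[OF hx(1), of r] sub S[of _ k] hx(2) by auto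
      then show "vol m (B x r) = vol (line_measure \<gamma>) (B' k r)"
        using levels(2)[OF finite_line_ball, of k r] vol_B[OF hx(1), of r] by (simp add: vol_B')
    qed
    show "comparable_on {(x, r). x \<in> X \<and> 0 \<le> r \<and> B x r \<noteq> {x}}
       (\<lambda>(x, r). vol m (B x r)) (\<lambda>(x, r). model_volume d (\<rho> x rt) r)"
      unfolding comparable_on_def using C comparable vol_le vol_ge by (intro exI[of _ C]) auto
    have "(\<Sum>l\<in>line_ball k r - {k}. s l) \<le> (\<Sum>l\<in>line_ball k r. s l)" for k r
      using finite_line_ball s_ge_1 by (intro sum_mono2) (auto intro: order.trans[OF zero_le_one])
    then show "comparable_on {(k, x, r). x \<in> S k \<and> 0 \<le> r \<and> B x r \<noteq> {x}}
       (\<lambda>(k, x, r). vol (line_measure \<gamma>) (B' k r)) (\<lambda>(k, x, r). model_volume d (\<rho> x rt) r)"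
      unfolding comparable_on_def vol_B' using C comparable S by (intro exI[of _ C]) auto
    show "\<exists>C\<^sub>D>0. \<forall>R. \<forall>x\<in>X. \<rho> x rt \<le> R \<longrightarrow> volume_doubling_at X b m C\<^sub>D d R x"
      using doubling C by (intro exI[of _ "C * C"]) auto
  qed
qed

end
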